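(* Let $\Pi_{\mathrm{AHI}}$ be the product AHI cone in $n$ variables. Then $\Pi_{\mathrm{AHI}}\subseteq\Sigma_{n,2d}$, in the sense that every $f\in\Pi_{\mathrm{AHI}}$ of degree at most $2d$ is a sum of squares; moreover every element of $\Pi_{\mathrm{AHI}}$ admits an SOS certificate in closed form.
   Context: AHI polynomials: a polynomial in $n$ variables is an AHI polynomial if it has the form $p(x)=\big(\sum_{i=1}^n \lambda_i x^{\alpha(i)}\big)\big(\sum_{i=1}^n \lambda_i \prod_{j\neq i} x^{\alpha(j)}\big)-c\prod_{i=1}^n x^{\alpha(i)}$ with $\lambda_i\ge 0$, $c\in\mathbb{R}$, and each $x^{\alpha(i)}$ a squared monomial in $x_1,\dots,x_n$ (all exponents even non-negative integers). $\mathrm{AHI}$ is the set of those that are non-negative on $\mathbb{R}^n$. The product AHI cone $\Pi_{\mathrm{AHI}}$ is the conic hull (set of finite non-negative linear combinations) of all finite products $\prod_{l=1}^k p_l$ with $k\in\mathbb{N}$, $p_1,\dots,p_k\in\mathrm{AHI}$. $\Sigma_{n,2d}$ is the cone of polynomials in $n$ variables of degree at most $2d$ that are sums of squares of polynomials. "SOS certificate in closed form" means a sum-of-squares representation obtained without solving a semidefinite program, by multiplying out and conically combining the explicit decompositions of the factors $$p=\sum_{1\le i<j\le n}\lambda_i\lambda_j\big(x^{\alpha(i)}-x^{\alpha(j)}\big)^2\prod_{k\ne i,j}x^{\alpha(k)}+\kappa\prod_{i=1}^nx^{\alpha(i)},\qquad \kappa=\Big(\sum_{i=1}^n\lambda_i\Big)^2-c\ge0,$$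 of each $p\in\mathrm{AHI}$, where every $x^{\alpha(i)}$ is a squared monomial. *)

theory Defs
  imports "HOL-Analysis.Analysis" "HOL-Library.Poly_Mapping"
begin

text \<open>
  Polynomials in n variables are finitely supported maps from exponent vectors to coefficients,
  with convolution as multiplication. The variables, like the summands of an AHI polynomial, are
  indexed by a finite linearly ordered type \<open>'n\<close> with n elements, which stands for {1,...,n}.
\<close>

type_synonym 'n mpoly = "('n \<Rightarrow>\<^sub>0 nat) \<Rightarrow>\<^sub>0 real"

abbreviation Const :: "real \<Rightarrow> 'n mpoly" where
  "Const a \<equiv> Poly_Mapping.single 0 a"

abbreviation Mon :: "('n \<Rightarrow>\<^sub>0 nat) \<Rightarrow> 'n mpoly" where
  "Mon a \<equiv> Poly_Mapping.single a 1"

definition eval_mpoly :: "real ^ 'n \<Rightarrow> 'n::finite mpoly \<Rightarrow> real" where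
  "eval_mpoly x p =
    (\<Sum>m\<in>Poly_Mapping.keys p. Poly_Mapping.lookup p m * (\<Prod>i\<in>UNIV. (x $ i) ^ Poly_Mapping.lookup m i))"

text \<open>The zero polynomial gets degree 0.\<close>

definition total_degree :: "'n::finite mpoly \<Rightarrow> nat" where
  "total_degree p =
    Max (insert 0 ((\<lambda>m. \<Sum>i\<in>UNIV. Poly_Mapping.lookup m i) ` Poly_Mapping.keys p))"

definition sos_certificate :: "'n mpoly \<Rightarrow> 'n mpoly list \<Rightarrow> bool" where
  "sos_certificate f qs \<longleftrightarrow> f = (\<Sum>q\<leftarrow>qs. q\<^sup>2)"

text \<open>The cone of sums of squares of degree at most \<open>k\<close> (used with \<open>k = 2 * d\<close>).\<close>

definition sos_cone :: "nat \<Rightarrow> 'n::finite mpoly set" where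
  "sos_cone k = {f. total_degree f \<le> k \<and> (\<exists>qs. sos_certificate f qs)}"

definition squared_exponent :: "('n \<Rightarrow>\<^sub>0 nat) \<Rightarrow> bool" where
  "squared_exponent a \<longleftrightarrow> (\<forall>i. even (Poly_Mapping.lookup a i))"

text \<open>The data \<open>(\<lambda>, \<alpha>, c)\<close> from which an AHI polynomial is built.\<close>

type_synonym 'n ahi_data = "('n \<Rightarrow> real) \<times> ('n \<Rightarrow> ('n \<Rightarrow>\<^sub>0 nat)) \<times> real"

fun ahi_poly :: "'n::finite ahi_data \<Rightarrow> 'n mpoly" where
  "ahi_poly (lam, alpha, c) =
    (\<Sum>i\<in>UNIV. Const (lam i) * Mon (alpha i)) *
    (\<Sum>i\<in>UNIV. Const (lam i) * (\<Prod>j\<in>UNIV - {i}. Mon (alpha j))) -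
    Const c * (\<Prod>i\<in>UNIV. Mon (alpha i))"

fun ahi_form :: "'n ahi_data \<Rightarrow> bool" where
  "ahi_form (lam, alpha, c) \<longleftrightarrow> (\<forall>i. 0 \<le> lam i) \<and> (\<forall>i. squared_exponent (alpha i))"

definition nonneg_poly :: "'n::finite mpoly \<Rightarrow> bool" where
  "nonneg_poly p \<longleftrightarrow> (\<forall>x :: real ^ 'n. 0 \<le> eval_mpoly x p)"

definition AHI :: "'n::finite mpoly set" where
  "AHI = {ahi_poly D | D. ahi_form D \<and> nonneg_poly (ahi_poly D)}"

text \<open>
  The empty product 1 is allowed; this does not change the cone, since 1 is itself in \<open>AHI\<close>
  (\<open>\<lambda> = 0\<close>, \<open>\<alpha> = 0\<close>, \<open>c = -1\<close>).
\<close>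

definition ahi_products :: "'n::finite mpoly set" where
  "ahi_products = {prod_list ps | ps. set ps \<subseteq> AHI}"

definition conic_hull :: "'n mpoly set \<Rightarrow> 'n mpoly set" where
  "conic_hull S = {\<Sum>g\<in>G. Const (\<mu> g) * g | G \<mu>. finite G \<and> G \<subseteq> S \<and> (\<forall>g\<in>G. 0 \<le> \<mu> g)}"

definition product_ahi_cone :: "'n::finite mpoly set" where
  "product_ahi_cone = conic_hull ahi_products"

text \<open>For a squared monomial with exponent \<open>a\<close>, \<open>Mon a = (Mon (half a))\<^sup>2\<close>.\<close>

definition half :: "('n \<Rightarrow>\<^sub>0 nat) \<Rightarrow> ('n \<Rightarrow>\<^sub>0 nat)" where
  "half a = Poly_Mapping.map (\<lambda>e. e div 2) a"

text \<open>
  The polynomials squared in the explicit decomposition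
  \<open>p = (\<Sum>i<j. \<lambda>\<^sub>i \<lambda>\<^sub>j (x^\<alpha>(i) - x^\<alpha>(j))\<^sup>2 (\<Prod>k\<noteq>i,j. x^\<alpha>(k))) + \<kappa> (\<Prod>i. x^\<alpha>(i))\<close> with
  \<open>\<kappa> = (\<Sum>i. \<lambda>\<^sub>i)\<^sup>2 - c\<close>. The non-negative scalars are absorbed into the squares as square roots.
  Since \<open>sqrt\<close> is odd on the reals, squaring \<open>sqrt \<kappa>\<close> yields \<open>\<kappa>\<close> only if \<open>\<kappa> \<ge> 0\<close>.
\<close>

fun ahi_roots :: "'n::{finite,linorder} ahi_data \<Rightarrow> 'n mpoly list" where
  "ahi_roots (lam, alpha, c) =
    [Const (sqrt (lam i * lam j)) * (Mon (alpha i) - Mon (alpha j)) *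
       (\<Prod>k\<in>UNIV - {i, j}. Mon (half (alpha k))).
     i \<leftarrow> sorted_list_of_set UNIV, j \<leftarrow> sorted_list_of_set UNIV, i < j] @
    [Const (sqrt ((\<Sum>i\<in>UNIV. lam i)\<^sup>2 - c)) * (\<Prod>i\<in>UNIV. Mon (half (alpha i)))]"

text \<open>Multiplying out a product of sums of squares: the pairwise products of the squared polynomials.\<close>

fun product_roots :: "'n::{finite,linorder} ahi_data list \<Rightarrow> 'n mpoly list" where
  "product_roots [] = [1]"
| "product_roots (D # Ds) = [q * r. q \<leftarrow> ahi_roots D, r \<leftarrow> product_roots Ds]"

text \<open>
  A list \<open>[(\<mu>\<^sub>1, Ds\<^sub>1), (\<mu>\<^sub>2, Ds\<^sub>2), \<dots>]\<close> stands for the conic combination of the products of the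
  AHI polynomials with data in \<open>Ds\<^sub>1\<close>, \<open>Ds\<^sub>2\<close>, and so on.
\<close>

type_synonym 'n ahi_rep = "(real \<times> 'n ahi_data list) list"

definition ahi_representation :: "'n::finite mpoly \<Rightarrow> 'n ahi_rep \<Rightarrow> bool" where
  "ahi_representation f R \<longleftrightarrow>
    (\<forall>(\<mu>, Ds)\<in>set R. 0 \<le> \<mu> \<and> (\<forall>D\<in>set Ds. ahi_form D \<and> nonneg_poly (ahi_poly D))) \<and>
    f = (\<Sum>(\<mu>, Ds)\<leftarrow>R. Const \<mu> * (\<Prod>D\<leftarrow>Ds. ahi_poly D))"

definition closed_form_roots :: "'n::{finite,linorder} ahi_rep \<Rightarrow> 'n mpoly list" where
  "closed_form_roots R = [Const (sqrt \<mu>) * q. (\<mu>, Ds) \<leftarrow> R, q \<leftarrow> product_roots Ds]"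

text \<open>
  The certificate is given by the explicit formula \<open>closed_form_roots\<close> in the data of a
  representation of \<open>f\<close>; nothing has to be solved for.
\<close>

definition closed_form_sos_certificate :: "'n::{finite,linorder} mpoly \<Rightarrow> 'n mpoly list \<Rightarrow> bool" where
  "closed_form_sos_certificate f qs \<longleftrightarrow>
    (\<exists>R. ahi_representation f R \<and> qs = closed_form_roots R) \<and> sos_certificate f qs"

end

theory Submission imports Defs begin

text \<open>
  For a single polynomial the decomposition is an identity between elements of a commutative ring.
  Write \<open>m i\<close> for the \<open>i\<close>-th monomial and \<open>P\<close> for the product of all of them. Multiplying out the
  two sums gives the terms \<open>\<lambda> i * \<lambda> j * m i * (P / m j)\<close>. Subtracting \<open>\<lambda> i * \<lambda> j * P\<close> from each
  kills the diagonal and turns the two terms for \<open>{i, j}\<close> into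
  \<open>\<lambda> i * \<lambda> j * (m i - m j)\<^sup>2 * (P / (m i * m j))\<close>; what was subtracted adds up to \<open>(\<Sum>i. \<lambda> i)\<^sup>2 * P\<close>.
  This is \<open>product_of_sums_minus_multiple\<close>. In it every monomial is a square, so only the sign of
  \<open>\<kappa> = (\<Sum>i. \<lambda> i)\<^sup>2 - c\<close> is in question. At the point \<open>(1,\<dots>,1)\<close> all squares \<open>(m i - m j)\<^sup>2\<close> vanish
  and \<open>P\<close> is 1, so \<open>\<kappa>\<close> is a value of the polynomial and is non-negative
  (\<open>eval_mpoly_ones_ahi_poly\<close>).

  Sums of squares are closed under products and non-negative combinations by distributivity,
  with \<open>q\<^sup>2 * r\<^sup>2 = (q * r)\<^sup>2\<close> and \<open>\<mu> * q\<^sup>2 = (sqrt \<mu> * q)\<^sup>2\<close>. The lists \<open>product_roots\<close> and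
  \<open>closed_form_roots\<close> record exactly these two steps, so every representation of an element of the
  cone yields its certificate (\<open>sos_certificate_closed_form_roots\<close>), and membership in the cone
  of sums of squares follows from the certificate.
\<close>

section \<open>The decomposition in a commutative ring\<close>

text \<open>The part of the sum with \<open>j < i\<close> is moved onto the pairs \<open>i < j\<close> by swapping the indices.\<close>

lemma sum_pairs_eq_sum_less:
  fixes d :: "'n::linorder \<Rightarrow> 'n \<Rightarrow> 'a::comm_monoid_add"
  assumes diag: "\<And>i. d i i = 0"
  shows "(\<Sum>i\<in>I. \<Sum>j\<in>I. d i j) = (\<Sum>i\<in>I. \<Sum>j\<in>I. if i < j then d i j + d j i else 0)"
proof -
  have split: "d i j = (if i < j then d i j else 0) + (if j < i then d i j else 0)" for i j
    using diag by (cases i j rule: linorder_cases) auto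
  have "(\<Sum>i\<in>I. \<Sum>j\<in>I. d i j)
      = (\<Sum>i\<in>I. \<Sum>j\<in>I. if i < j then d i j else 0) + (\<Sum>i\<in>I. \<Sum>j\<in>I. if j < i then d i j else 0)"
    unfolding sum.distrib[symmetric] by (intro sum.cong refl split)
  also have "(\<Sum>i\<in>I. \<Sum>j\<in>I. if j < i then d i j else 0) = (\<Sum>i\<in>I. \<Sum>j\<in>I. if i < j then d j i else 0)"
    by (rule sum.swap)
  finally show ?thesis
    unfolding sum.distrib[symmetric] by (auto intro!: sum.cong)
qed

text \<open>
  In place of the division by \<open>m j\<close> and \<open>m i * m j\<close> there are products over \<open>I - {j}\<close> and
  \<open>I - {i, j}\<close>, so the identity holds for zero divisors as well. The term \<open>d i j\<close> in the proof is the
  summand for \<open>(i, j)\<close> after its share \<open>l i * l j * P\<close> of \<open>(\<Sum>i. l i)\<^sup>2 * P\<close> has been taken off.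
\<close>

lemma product_of_sums_minus_multiple:
  fixes l m :: "'n::linorder \<Rightarrow> 'a::comm_ring_1"
  assumes "finite I"
  shows "(\<Sum>i\<in>I. l i * m i) * (\<Sum>i\<in>I. l i * (\<Prod>j\<in>I - {i}. m j)) - c * (\<Prod>i\<in>I. m i)
    = (\<Sum>i\<in>I. \<Sum>j\<in>I. if i < j then l i * l j * (m i - m j)\<^sup>2 * (\<Prod>k\<in>I - {i, j}. m k) else 0)
      + ((\<Sum>i\<in>I. l i)\<^sup>2 - c) * (\<Prod>i\<in>I. m i)"
proof -
  let ?P = "\<Prod>i\<in>I. m i"
  \<comment> \<open>On \<open>I\<close> the second case is 0 for \<open>i = j\<close> anyway. The first makes the diagonal vanish for
      indices outside \<open>I\<close> as well, which the pairing lemma asks for.\<close>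
  define d where "d i j =
    (if i = j then 0 else l i * m i * (l j * (\<Prod>k\<in>I - {j}. m k)) - l i * l j * ?P)" for i j
  have P: "?P = m j * (\<Prod>k\<in>I - {j}. m k)" if "j \<in> I" for j
    using assms that by (simp add: prod.remove)
  have Q: "(\<Prod>k\<in>I - {j}. m k) = m i * (\<Prod>k\<in>I - {i, j}. m k)" if "i \<in> I" "i \<noteq> j" for i j
  proof -
    have "I - {j} - {i} = I - {i, j}" by auto
    then show ?thesis
      using assms that by (simp add: prod.remove[of "I - {j}" i])
  qed
  have pair: "d i j + d j i = l i * l j * (m i - m j)\<^sup>2 * (\<Prod>k\<in>I - {i, j}. m k)"
    if "i \<in> I" "j \<in> I" "i < j" for i j
  proof -
    let ?R = "\<Prod>k\<in>I - {i, j}. m k"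
    have j: "(\<Prod>k\<in>I - {j}. m k) = m i * ?R" and i: "(\<Prod>k\<in>I - {i}. m k) = m j * ?R"
      using that Q[of i j] Q[of j i] by (simp_all add: insert_commute)
    have P: "?P = m j * (m i * ?R)"
      using P[OF \<open>j \<in> I\<close>] unfolding j .
    have "i \<noteq> j" "j \<noteq> i"
      using that by auto
    then have "d i j + d j i = l i * m i * (l j * (m i * ?R)) - l i * l j * (m j * (m i * ?R))
        + (l j * m j * (l i * (m j * ?R)) - l j * l i * (m j * (m i * ?R)))"
      by (simp only: d_def i j P if_False)
    also have "\<dots> = l i * l j * (m i - m j)\<^sup>2 * ?R"
      by (simp add: power2_eq_square algebra_simps)
    finally show ?thesis .
  qed
  have "(\<Sum>i\<in>I. l i * m i) * (\<Sum>i\<in>I. l i * (\<Prod>j\<in>I - {i}. m j)) - (\<Sum>i\<in>I. l i)\<^sup>2 * ?P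
      = (\<Sum>i\<in>I. \<Sum>j\<in>I. l i * m i * (l j * (\<Prod>k\<in>I - {j}. m k)) - l i * l j * ?P)"
    unfolding power2_eq_square sum_product unfolding sum_distrib_right sum_subtractf ..
  also have "\<dots> = (\<Sum>i\<in>I. \<Sum>j\<in>I. d i j)"
    by (intro sum.cong refl) (auto simp: d_def P ac_simps)
  also have "\<dots> = (\<Sum>i\<in>I. \<Sum>j\<in>I. if i < j then d i j + d j i else 0)"
    by (rule sum_pairs_eq_sum_less) (simp add: d_def)
  also have "\<dots> = (\<Sum>i\<in>I. \<Sum>j\<in>I.
      if i < j then l i * l j * (m i - m j)\<^sup>2 * (\<Prod>k\<in>I - {i, j}. m k) else 0)"
    by (intro sum.cong refl) (simp add: pair)
  finally show ?thesis
    by (simp add: algebra_simps)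
qed

section \<open>Monomials and evaluation at the all-ones point\<close>

lemma Const_mult: "Const a * Const b = Const (a * b)"
  by (simp add: mult_single)

lemma Const_sum: "(\<Sum>i\<in>I. Const (f i)) = Const (\<Sum>i\<in>I. f i)"
  by (induction I rule: infinite_finite_induct) (simp_all add: single_add)

lemma Const_sqrt_power2:
  assumes "0 \<le> a"
  shows "(Const (sqrt a))\<^sup>2 = Const a"
  using assms by (simp add: power2_eq_square Const_mult)

lemma prod_Mon: "(\<Prod>i\<in>I. Mon (a i)) = (Mon (\<Sum>i\<in>I. a i) :: 'n mpoly)"
  by (induction I rule: infinite_finite_induct) (simp_all add: mult_single)

lemma Mon_half_power2:
  assumes "squared_exponent a"
  shows "(Mon (half a))\<^sup>2 = (Mon a :: 'n mpoly)"
proof -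
  have "half a + half a = a"
    using assms
    by (intro poly_mapping_eqI)
      (auto simp: half_def squared_exponent_def lookup_add map.rep_eq when_def simp flip: mult_2)
  then show ?thesis
    by (simp add: power2_eq_square mult_single)
qed

lemma eval_mpoly_ones:
  assumes "finite K" "Poly_Mapping.keys p \<subseteq> K"
  shows "eval_mpoly 1 p = (\<Sum>m\<in>K. Poly_Mapping.lookup p m)"
  unfolding eval_mpoly_def using assms
  by (auto intro!: sum.mono_neutral_left simp: in_keys_iff)

lemma eval_mpoly_ones_add: "eval_mpoly 1 (p + q) = eval_mpoly 1 p + eval_mpoly 1 q"
proof -
  let ?K = "Poly_Mapping.keys p \<union> Poly_Mapping.keys q"
  have "Poly_Mapping.keys (p + q) \<subseteq> ?K"
    by (rule keys_add)
  then show ?thesis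
    by (simp add: eval_mpoly_ones[of ?K] lookup_add sum.distrib)
qed

lemma eval_mpoly_ones_single: "eval_mpoly 1 (Poly_Mapping.single a b) = b"
  by (simp add: eval_mpoly_ones[of "{a}"])

lemma eval_mpoly_ones_sum: "eval_mpoly 1 (\<Sum>i\<in>I. p i) = (\<Sum>i\<in>I. eval_mpoly 1 (p i))"
  by (induction I rule: infinite_finite_induct)
    (simp_all add: eval_mpoly_ones_add eval_mpoly_ones[of "{}" 0])

text \<open>
  Multiplied out, an AHI polynomial is a combination of monomials, and each monomial is 1 at the
  all-ones point.
\<close>

lemma eval_mpoly_ones_ahi_poly: "eval_mpoly 1 (ahi_poly (lam, alpha, c)) = (\<Sum>i\<in>UNIV. lam i)\<^sup>2 - c"
proof -
  have neg: "p - Const c * Mon a = p + Poly_Mapping.single a (- c)"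
    for p :: "'n::finite mpoly" and a
    by (simp add: mult_single single_uminus)
  show ?thesis
    unfolding ahi_poly.simps prod_Mon neg sum_product
    by (simp add: mult_single eval_mpoly_ones_add eval_mpoly_ones_sum eval_mpoly_ones_single
        power2_eq_square sum_product)
qed

section \<open>Certificates for the factors, their products and conic combinations\<close>

lemma sum_list_concat_map:
  "(\<Sum>x\<leftarrow>concat (map g xs). f x) = (\<Sum>x\<leftarrow>xs. \<Sum>y\<leftarrow>g x. (f y :: 'a::comm_monoid_add))"
  by (induction xs) simp_all

lemma sum_list_sorted_list_of_UNIV:
  "(\<Sum>i\<leftarrow>sorted_list_of_set (UNIV :: 'n::{finite,linorder} set). f i) = (\<Sum>i\<in>UNIV. f i)"
  by (simp add: sum.distinct_set_conv_list[symmetric])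

text \<open>
  Non-negativity of the polynomial enters only through \<open>\<kappa> \<ge> 0\<close>, which is what makes
  \<open>(sqrt \<kappa>)\<^sup>2 = \<kappa>\<close>; the even exponents give each remaining monomial as the square of its half.
\<close>

lemma sos_certificate_ahi_roots:
  fixes D :: "'n::{finite,linorder} ahi_data"
  assumes "ahi_form D" "nonneg_poly (ahi_poly D)"
  shows "sos_certificate (ahi_poly D) (ahi_roots D)"
proof -
  obtain lam alpha c where D: "D = (lam, alpha, c)"
    by (cases D)
  let ?\<kappa> = "(\<Sum>i\<in>UNIV. lam i)\<^sup>2 - c"
  have lam: "0 \<le> lam i" and sq: "squared_exponent (alpha i)" for i
    using assms(1) by (simp_all add: D)
  have \<kappa>: "0 \<le> ?\<kappa>"
    using assms(2) eval_mpoly_ones_ahi_poly[of lam alpha c] unfolding D nonneg_poly_def by metis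
  have half_prod: "(\<Prod>k\<in>I. Mon (half (alpha k)))\<^sup>2 = (\<Prod>k\<in>I. Mon (alpha k))" for I
    by (simp add: prod_power_distrib Mon_half_power2 sq)
  have Const_\<kappa>: "(\<Sum>i\<in>UNIV. Const (lam i))\<^sup>2 - Const c = (Const ?\<kappa> :: 'n mpoly)"
    by (simp add: Const_sum power2_eq_square Const_mult single_diff)
  have "(\<Sum>q\<leftarrow>ahi_roots D. q\<^sup>2) =
      (\<Sum>i\<in>UNIV. \<Sum>j\<in>UNIV. if i < j then Const (lam i) * Const (lam j) *
        (Mon (alpha i) - Mon (alpha j))\<^sup>2 * (\<Prod>k\<in>UNIV - {i, j}. Mon (alpha k)) else 0)
      + Const ?\<kappa> * (\<Prod>i\<in>UNIV. Mon (alpha i))"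
    by (simp add: D sum_list_concat_map sum_list_sorted_list_of_UNIV power_mult_distrib half_prod
        Const_sqrt_power2 Const_sqrt_power2[OF \<kappa>] lam Const_mult if_distrib[of "map _"] if_distrib[of sum_list]
        cong: if_cong)
  also have "\<dots> = ahi_poly D"
    unfolding D ahi_poly.simps product_of_sums_minus_multiple[OF finite] Const_\<kappa> ..
  finally show ?thesis
    by (simp add: sos_certificate_def)
qed

lemma sos_certificate_product_roots:
  fixes Ds :: "'n::{finite,linorder} ahi_data list"
  assumes "\<And>D. D \<in> set Ds \<Longrightarrow> ahi_form D \<and> nonneg_poly (ahi_poly D)"
  shows "sos_certificate (\<Prod>D\<leftarrow>Ds. ahi_poly D) (product_roots Ds)"
  using assms
proof (induction Ds)
  case Nil
  then show ?case by (simp add: sos_certificate_def)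
next
  case (Cons D Ds)
  have D: "ahi_poly D = (\<Sum>q\<leftarrow>ahi_roots D. q\<^sup>2)"
    using sos_certificate_ahi_roots[of D] Cons.prems by (simp add: sos_certificate_def)
  have Ds: "(\<Prod>D\<leftarrow>Ds. ahi_poly D) = (\<Sum>r\<leftarrow>product_roots Ds. r\<^sup>2)"
    using Cons by (simp add: sos_certificate_def)
  show ?case
    by (simp add: sos_certificate_def D Ds sum_list_concat_map o_def power_mult_distrib
        sum_list_const_mult sum_list_mult_const)
qed

lemma sos_certificate_closed_form_roots:
  fixes f :: "'n::{finite,linorder} mpoly"
  assumes "ahi_representation f R"
  shows "sos_certificate f (closed_form_roots R)"
proof -
  have scaled: "(\<Sum>q\<leftarrow>product_roots Ds. (Const (sqrt \<mu>) * q)\<^sup>2) = Const \<mu> * (\<Prod>D\<leftarrow>Ds. ahi_poly D)"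
    if "(\<mu>, Ds) \<in> set R" for \<mu> Ds
  proof -
    have "0 \<le> \<mu>" and "\<And>D. D \<in> set Ds \<Longrightarrow> ahi_form D \<and> nonneg_poly (ahi_poly D)"
      using assms that by (auto simp: ahi_representation_def)
    then show ?thesis
      using sos_certificate_product_roots[of Ds]
      by (simp add: power_mult_distrib Const_sqrt_power2 sum_list_const_mult sos_certificate_def)
  qed
  have "(\<Sum>q\<leftarrow>closed_form_roots R. q\<^sup>2)
      = (\<Sum>(\<mu>, Ds)\<leftarrow>R. \<Sum>q\<leftarrow>product_roots Ds. (Const (sqrt \<mu>) * q)\<^sup>2)"
    unfolding closed_form_roots_def sum_list_concat_map
    by (intro arg_cong[where f = sum_list] map_cong refl) (auto simp: o_def)
  also have "\<dots> = (\<Sum>(\<mu>, Ds)\<leftarrow>R. Const \<mu> * (\<Prod>D\<leftarrow>Ds. ahi_poly D))"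
    using scaled by (intro arg_cong[where f = sum_list] map_cong) auto
  finally show ?thesis
    using assms by (simp add: ahi_representation_def sos_certificate_def)
qed

lemma ahi_products_imp_data:
  assumes "g \<in> ahi_products"
  shows "\<exists>Ds. g = (\<Prod>D\<leftarrow>Ds. ahi_poly D) \<and> (\<forall>D\<in>set Ds. ahi_form D \<and> nonneg_poly (ahi_poly D))"
proof -
  obtain ps where g: "g = prod_list ps" and "set ps \<subseteq> AHI"
    using assms by (auto simp: ahi_products_def)
  then have "\<forall>p\<in>set ps. \<exists>D. p = ahi_poly D \<and> ahi_form D \<and> nonneg_poly (ahi_poly D)"
    by (auto simp: AHI_def)
  then obtain D where "\<forall>p\<in>set ps. p = ahi_poly (D p) \<and> ahi_form (D p) \<and> nonneg_poly (ahi_poly (D p))"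
    by metis
  then show ?thesis
    by (intro exI[of _ "map D ps"])
      (auto simp: g o_def intro!: arg_cong[where f = prod_list] map_idI[symmetric])
qed

lemma product_ahi_cone_imp_representation:
  assumes "f \<in> product_ahi_cone"
  shows "\<exists>R. ahi_representation f R"
proof -
  obtain G \<mu> where f: "f = (\<Sum>g\<in>G. Const (\<mu> g) * g)" and "finite G"
    and G: "G \<subseteq> ahi_products" and \<mu>: "\<forall>g\<in>G. 0 \<le> \<mu> g"
    using assms by (auto simp: product_ahi_cone_def conic_hull_def)
  obtain Ds where Ds: "\<And>g. g \<in> G \<Longrightarrow> g = (\<Prod>D\<leftarrow>Ds g. ahi_poly D)"
      "\<And>g D. g \<in> G \<Longrightarrow> D \<in> set (Ds g) \<Longrightarrow> ahi_form D \<and> nonneg_poly (ahi_poly D)"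
    using ahi_products_imp_data G by (metis subsetD)
  obtain gs where gs: "set gs = G" "distinct gs"
    using finite_distinct_list[OF \<open>finite G\<close>] by blast
  have "f = (\<Sum>g\<leftarrow>gs. Const (\<mu> g) * g)"
    using gs by (simp add: f sum.distinct_set_conv_list[symmetric])
  also have "\<dots> = (\<Sum>g\<leftarrow>gs. Const (\<mu> g) * (\<Prod>D\<leftarrow>Ds g. ahi_poly D))"
    using gs Ds(1) by (intro arg_cong[where f = sum_list] map_cong) auto
  finally have "ahi_representation f (map (\<lambda>g. (\<mu> g, Ds g)) gs)"
    using gs \<mu> Ds(2) by (auto simp: ahi_representation_def o_def)
  then show ?thesis ..
qed

theorem proposition4p6:
  fixes d :: nat
  shows "{f \<in> (product_ahi_cone :: 'n::{finite,linorder} mpoly set). total_degree f \<le> 2 * d}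
           \<subseteq> sos_cone (2 * d)
       \<and> (\<forall>f \<in> (product_ahi_cone :: 'n mpoly set). \<exists>qs. closed_form_sos_certificate f qs)"
proof -
  have "\<exists>qs. closed_form_sos_certificate f qs" if "f \<in> product_ahi_cone" for f :: "'n mpoly"
    using product_ahi_cone_imp_representation[OF that] sos_certificate_closed_form_roots
    unfolding closed_form_sos_certificate_def by blast
  then show ?thesis
    unfolding sos_cone_def closed_form_sos_certificate_def by blast
qed

end
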